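(* Suppose that there are two targets $t_1,t_2$. Any deterministic (possibly adaptive) algorithm needs in the worst case at least $\frac{n}{2}-1$ two-direction queries to detect one of the two targets, even when the graph is an unweighted cycle with $n$ vertices.
   Context: Graphs $G=(V,E)$, $|V|=n$, are connected, simple, undirected, with positive edge weights $w$ (unweighted: all weights $1$); $d$ is the shortest-path distance, and $N(v)$ is the set of neighbors of $v$. For $u\in N(v)$, $N(v,u)=\{x\in V: d(v,x)=w(vu)+d(u,x)\}$. The unknown (distinct) targets $t_1,t_2\in V$ are placed by an adversary. A two-direction query at vertex $v$ returns an unordered pair of (not necessarily distinct) vertices $\{u,u'\}\subseteq N(v)$ such that $t_1\in N(v,u)$ and $t_2\in N(v,u')$; since the pair is unordered, the response does not clarify which target belongs to $N(v,u)$ and which to $N(v,u')$. If $v$ is itself a target, the query reveals this. To detect a target means to determine with certainty some vertex that is a target. *)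

theory Defs
  imports
    "Graph_Theory.Digraph_Component"
    "Graph_Theory.Shortest_Path"
    "HOL-Library.Uprod"
begin

text \<open>
  An undirected simple graph is a symmetric loop-free digraph (locale \<^locale>\<open>pair_graph\<close>):
  every edge is represented by its two arcs, and a weight function assigns a real to each arc.
\<close>

locale weighted_connected_graph = pair_graph G
  for G :: "'a pair_pre_digraph" +
  fixes w :: "('a \<times> 'a) weight_fun"
  assumes connected: "connected G"
    and weight_pos: "e \<in> parcs G \<Longrightarrow> 0 < w e"
    and weight_sym: "(u, v) \<in> parcs G \<Longrightarrow> w (u, v) = w (v, u)"

definition nbrs :: "'a pair_pre_digraph \<Rightarrow> 'a \<Rightarrow> 'a set" where
  "nbrs G v = {u. (v, u) \<in> parcs G}"

text \<open>\<open>nbrs_towards G w v u\<close> is the set $N(v,u)$.\<close>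

definition nbrs_towards ::
    "'a pair_pre_digraph \<Rightarrow> ('a \<times> 'a) weight_fun \<Rightarrow> 'a \<Rightarrow> 'a \<Rightarrow> 'a set" where
  "nbrs_towards G w v u =
     {x \<in> pverts G. wf_digraph.\<mu> G w v x = ereal (w (v, u)) + wf_digraph.\<mu> G w u x}"

datatype 'a answer = Is_Target | Directions "'a uprod"

text \<open>
  \<open>valid_answer G w t1 t2 v a\<close>: \<open>a\<close> is an admissible answer to a two-direction query at \<open>v\<close> when
  the targets are \<open>t1\<close> and \<open>t2\<close>. Several answers can be admissible, since shortest paths
  need not be unique.
\<close>

fun valid_answer ::
    "'a pair_pre_digraph \<Rightarrow> ('a \<times> 'a) weight_fun \<Rightarrow> 'a \<Rightarrow> 'a \<Rightarrow> 'a \<Rightarrow> 'a answer \<Rightarrow> bool" where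
  "valid_answer G w t1 t2 v Is_Target \<longleftrightarrow> v = t1 \<or> v = t2"
| "valid_answer G w t1 t2 v (Directions p) \<longleftrightarrow> v \<noteq> t1 \<and> v \<noteq> t2 \<and>
     (\<exists>u\<in>nbrs G v. \<exists>u'\<in>nbrs G v. p = Upair u u' \<and>
        t1 \<in> nbrs_towards G w v u \<and> t2 \<in> nbrs_towards G w v u')"

text \<open>
  A history lists the queried vertices with the answers received, oldest first. A deterministic
  adaptive algorithm maps the history so far to the vertex queried next.
\<close>

type_synonym 'a history = "('a \<times> 'a answer) list"
type_synonym 'a algorithm = "'a history \<Rightarrow> 'a"

definition query_algorithm :: "'a pair_pre_digraph \<Rightarrow> 'a algorithm \<Rightarrow> bool" where
  "query_algorithm G A \<longleftrightarrow> (\<forall>h. A h \<in> pverts G)"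

definition target_pair :: "'a pair_pre_digraph \<Rightarrow> 'a \<Rightarrow> 'a \<Rightarrow> bool" where
  "target_pair G t1 t2 \<longleftrightarrow> t1 \<in> pverts G \<and> t2 \<in> pverts G \<and> t1 \<noteq> t2"

definition consistent ::
    "'a pair_pre_digraph \<Rightarrow> ('a \<times> 'a) weight_fun \<Rightarrow> 'a \<Rightarrow> 'a \<Rightarrow> 'a history \<Rightarrow> bool" where
  "consistent G w t1 t2 h \<longleftrightarrow>
     target_pair G t1 t2 \<and> (\<forall>(v, a)\<in>set h. valid_answer G w t1 t2 v a)"

definition run_of :: "'a algorithm \<Rightarrow> 'a history \<Rightarrow> bool" where
  "run_of A h \<longleftrightarrow> (\<forall>i<length h. fst (h ! i) = A (take i h))"

text \<open>
  Some single vertex belongs to every placement of the targets that the history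
  does not rule out.
\<close>

definition target_detected ::
    "'a pair_pre_digraph \<Rightarrow> ('a \<times> 'a) weight_fun \<Rightarrow> 'a history \<Rightarrow> bool" where
  "target_detected G w h \<longleftrightarrow>
     (\<exists>x\<in>pverts G. \<forall>t1 t2. consistent G w t1 t2 h \<longrightarrow> x = t1 \<or> x = t2)"

text \<open>
  The worst-case bound: whatever the placement of the targets and the admissible answers chosen
  by the adversary, a target is detected after at most \<open>q\<close> queries.
\<close>

definition detects_within ::
    "'a pair_pre_digraph \<Rightarrow> ('a \<times> 'a) weight_fun \<Rightarrow> 'a algorithm \<Rightarrow> nat \<Rightarrow> bool" where
  "detects_within G w A q \<longleftrightarrow>
     (\<forall>t1 t2 h. consistent G w t1 t2 h \<and> run_of A h \<and> length h = q \<longrightarrow>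
        (\<exists>k\<le>q. target_detected G w (take k h)))"

definition cycle_graph :: "nat \<Rightarrow> 'a pair_pre_digraph \<Rightarrow> bool" where
  "cycle_graph n G \<longleftrightarrow> 3 \<le> n \<and>
     (\<exists>f. bij_betw f {..<n} (pverts G) \<and>
        parcs G = (\<Union>i<n. {(f i, f (Suc i mod n)), (f (Suc i mod n), f i)}))"

lemma cycle_graph_card: "cycle_graph n G \<Longrightarrow> card (pverts G) = n"
  by (metis bij_betw_same_card card_lessThan cycle_graph_def)

lemma cycle_graph_weighted_connected_graph:
  assumes "cycle_graph n G"
  shows "weighted_connected_graph G (\<lambda>_. 1)"
proof -
  obtain f where n: "3 \<le> n" and f: "bij_betw f {..<n} (pverts G)"
    and E: "parcs G = (\<Union>i<n. {(f i, f (Suc i mod n)), (f (Suc i mod n), f i)})"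
    using assms unfolding cycle_graph_def by blast
  have V: "pverts G = f ` {..<n}" and inj: "inj_on f {..<n}"
    using f by (auto simp: bij_betw_def)
  have neq: "Suc i mod n \<noteq> i" if "i < n" for i
    using that n by (cases "Suc i = n") auto
  interpret pair_graph G
  proof unfold_locales
    show "finite (pverts G)" by (simp add: V)
    show "finite (parcs G)" by (simp add: E)
    show "fst e \<in> pverts G" "snd e \<in> pverts G" if "e \<in> parcs G" for e
      using that n by (auto simp: E V)
    show "symmetric G" unfolding symmetric_def by (auto simp: E sym_def)
    show "fst e \<noteq> snd e" if "e \<in> parcs G" for e
    proof -
      obtain i where i: "i < n" "e = (f i, f (Suc i mod n)) \<or> e = (f (Suc i mod n), f i)"
        using \<open>e \<in> parcs G\<close> unfolding E by blast
      have "f (Suc i mod n) \<noteq> f i"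
        using inj_onD[OF inj, of "Suc i mod n" i] neq[OF i(1)] i(1) n by auto
      then show ?thesis using i(2) by auto
    qed
  qed
  have fromZero: "f 0 \<rightarrow>\<^sup>*\<^bsub>with_proj G\<^esub> f i" if "i < n" for i
    using that
  proof (induction i)
    case 0
    then show ?case using V by auto
  next
    case (Suc i)
    then have "(f i, f (Suc i)) = (f i, f (Suc i mod n))" "i \<in> {..<n}" by auto
    then have "(f i, f (Suc i)) \<in> parcs G" unfolding E by blast
    then have "f i \<rightarrow>\<^bsub>with_proj G\<^esub> f (Suc i)" by simp
    moreover have "f 0 \<rightarrow>\<^sup>*\<^bsub>with_proj G\<^esub> f i" using Suc by simp
    ultimately show ?case using wf_digraph.reachable_adj_trans[OF wf_digraph] by blast
  qed
  have toZero: "f i \<rightarrow>\<^sup>*\<^bsub>with_proj G\<^esub> f 0" if "i < n" for i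
    using symmetric_reachable[OF pair_sym_arcs fromZero[OF that]] .
  have sc: "strongly_connected G"
  proof (rule strongly_connectedI)
    show "verts G \<noteq> {}" using n by (simp add: V lessThan_empty_iff)
    fix u v assume "u \<in> verts G" "v \<in> verts G"
    then obtain i j where "i < n" "u = f i" "j < n" "v = f j" by (auto simp: V)
    then show "u \<rightarrow>\<^sup>*\<^bsub>with_proj G\<^esub> v"
      using wf_digraph.reachable_trans[OF wf_digraph toZero fromZero] by simp
  qed
  have "mk_symmetric G = G"
  proof (rule pair_pre_digraph.equality)
    show "parcs (mk_symmetric G) = parcs G"
      by (auto simp: mk_symmetric_def E)
  qed (simp_all add: mk_symmetric_def)
  then have "connected G"
    using sc by (simp add: connected_def)
  then show ?thesis by unfold_locales auto
qed

end

theory Submission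
  imports Defs
begin

text \<open>
  Put \<open>m = n div 2\<close>. The adversary only considers the \<open>n\<close> almost antipodal placements
  \<open>{i, i + m}\<close> and answers every query with both neighbours of the queried vertex. Such an answer
  excludes only the at most two placements that contain the queried vertex. If \<open>2 * q + 2 < n\<close>,
  then after \<open>q\<close> queries at least three placements survive, and since any vertex lies on at
  most two of them, no vertex is known to be a target.
\<close>

text \<open>
  The cycle is labelled by all integers, with period \<open>n\<close>, so that a step in either direction
  is an addition without wrap-around.
\<close>

locale labelled_cycle = pair_graph G for G :: "'a pair_pre_digraph" +
  fixes n :: nat and F :: "int \<Rightarrow> 'a"
  assumes n_ge_3: "3 \<le> n"
    and label_eq_iff: "F a = F b \<longleftrightarrow> int n dvd a - b"
    and verts_eq: "pverts G = range F"
    and arc_iff: "(u, v) \<in> parcs G \<longleftrightarrow> (\<exists>a. u = F a \<and> (v = F (a + 1) \<or> v = F (a - 1)))"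
begin

section \<open>Arcs, walks and distances in the labelled cycle\<close>

lemma label_shift: "F a = F b \<Longrightarrow> F (a + c) = F (b + c)"
  by (simp add: label_eq_iff)

lemma label_in_verts [simp]: "F a \<in> pverts G"
  by (simp add: verts_eq)

lemma arc_step: "\<bar>s\<bar> = 1 \<Longrightarrow> (F a, F (a + s)) \<in> parcs G"
  unfolding arc_iff by (rule exI[of _ a]) (auto simp: abs_if split: if_splits)

lemma arc_from_label:
  assumes "(F a, v) \<in> parcs G"
  obtains s where "\<bar>s\<bar> = 1" "v = F (a + s)"
proof -
  obtain b where b: "F a = F b" "v = F (b + 1) \<or> v = F (b - 1)"
    using assms unfolding arc_iff by blast
  from b(2) show thesis
  proof
    assume "v = F (b + 1)"
    then show thesis using that[of 1] label_shift[OF b(1), of 1] by simp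
  next
    assume "v = F (b - 1)"
    then show thesis using that[of "-1"] label_shift[OF b(1), of "-1"] by simp
  qed
qed

lemma awalk_around:
  assumes "\<bar>s\<bar> = 1"
  shows "\<exists>p. awalk (F a) p (F (a + s * int k)) \<and> length p = k"
proof (induction k arbitrary: a)
  case 0
  show ?case by (intro exI[of _ "[]"]) (simp add: awalk_Nil_iff)
next
  case (Suc k)
  obtain p where "awalk (F (a + s)) p (F (a + s + s * int k))" "length p = k"
    using Suc by blast
  then have "awalk (F a) ((F a, F (a + s)) # p) (F (a + s * int (Suc k)))"
    using arc_step[OF assms] by (simp add: awalk_Cons_iff algebra_simps)
  then show ?case using \<open>length p = k\<close> by (metis length_Cons)
qed

text \<open>Each arc moves the label by one in either direction, so the signed steps add up to
  \<open>k\<close>. This is the source of the lower bound on distances.\<close>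

lemma awalk_displacement:
  assumes "awalk (F a) p v"
  shows "\<exists>k. v = F (a + k) \<and> \<bar>k\<bar> \<le> int (length p)"
  using assms
proof (induction p arbitrary: a)
  case Nil
  then show ?case by (intro exI[of _ 0]) (simp add: awalk_Nil_iff)
next
  case (Cons e p)
  then have e: "(F a, snd e) \<in> parcs G" "awalk (snd e) p v"
    by (auto simp: awalk_Cons_iff)
  obtain s where s: "\<bar>s\<bar> = 1" "snd e = F (a + s)" using arc_from_label[OF e(1)] .
  obtain k where "v = F (a + s + k)" "\<bar>k\<bar> \<le> int (length p)"
    using Cons.IH[of "a + s"] e(2) s(2) by auto
  then show ?case using s(1) by (intro exI[of _ "s + k"]) (auto simp: algebra_simps)
qed

lemma unit_awalk_cost: "awalk_cost (\<lambda>_. 1) p = real (length p)"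
  by (induction p) auto

text \<open>Walking straight costs \<open>\<bar>j\<bar>\<close>. Conversely, a walk of displacement
  \<open>k\<close> needs at least \<open>\<bar>k\<bar>\<close> arcs, and \<open>k\<close> agrees
  with \<open>j\<close> modulo \<open>n\<close>; up to half the cycle, no such \<open>k\<close> is
  shorter than \<open>j\<close>.\<close>

lemma distance:
  assumes "2 * \<bar>j\<bar> \<le> int n"
  shows "\<mu> (\<lambda>_. 1) (F a) (F (a + j)) = ereal (real_of_int \<bar>j\<bar>)"
proof (rule antisym)
  obtain s :: int where s: "\<bar>s\<bar> = 1" "j = s * int (nat \<bar>j\<bar>)"
    by (cases "j \<ge> 0") (auto intro: that[of 1] that[of "-1"])
  obtain p where p: "awalk (F a) p (F (a + j))" "length p = nat \<bar>j\<bar>"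
    using awalk_around[OF s(1), of a "nat \<bar>j\<bar>"] s(2) by auto
  show "\<mu> (\<lambda>_. 1) (F a) (F (a + j)) \<le> ereal (real_of_int \<bar>j\<bar>)"
    using min_cost_le_walk_cost[OF p(1), of "\<lambda>_. 1"] p(2) by (simp add: unit_awalk_cost)
next
  have "\<bar>j\<bar> \<le> int (length p)" if p: "awalk (F a) p (F (a + j))" for p
  proof -
    obtain k where k: "F (a + j) = F (a + k)" "\<bar>k\<bar> \<le> int (length p)"
      using awalk_displacement[OF p] by blast
    have "\<bar>j\<bar> \<le> \<bar>k\<bar>"
    proof (rule ccontr)
      assume less: "\<not> \<bar>j\<bar> \<le> \<bar>k\<bar>"
      have "int n dvd j - k" using k(1) by (simp add: label_eq_iff)
      \<comment> \<open>From \<open>\<bar>k\<bar> < \<bar>j\<bar>\<close> follows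
        \<open>\<bar>j - k\<bar> < 2 * \<bar>j\<bar> \<le> n\<close>, too small for a nonzero
        multiple of \<open>n\<close>.\<close>
      moreover have "\<bar>j - k\<bar> < int n" "j - k \<noteq> 0" using less assms by auto
      ultimately show False using zdvd_not_zless[of "\<bar>j - k\<bar>" "int n"] by auto
    qed
    then show ?thesis using k(2) by simp
  qed
  then have "real_of_int \<bar>j\<bar> \<le> real (length p)" if "awalk (F a) p (F (a + j))" for p
    using that of_int_le_iff[of "\<bar>j\<bar>" "int (length p)", where 'a = real] by simp
  then show "ereal (real_of_int \<bar>j\<bar>) \<le> \<mu> (\<lambda>_. 1) (F a) (F (a + j))"
    unfolding \<mu>_def by (intro INF_greatest) (simp add: unit_awalk_cost)
qed

lemma in_nbrs_towards:
  assumes "\<bar>s\<bar> = 1" "1 \<le> j" "2 * j \<le> int n"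
  shows "F (a + s * j) \<in> nbrs_towards G (\<lambda>_. 1) (F a) (F (a + s))"
proof -
  have s: "s = 1 \<or> s = -1" using assms(1) by auto
  have "\<mu> (\<lambda>_. 1) (F a) (F (a + s * j)) = ereal (real_of_int j)"
    using distance[of "s * j" a] s assms by auto
  moreover have "\<mu> (\<lambda>_. 1) (F (a + s)) (F (a + s + s * (j - 1))) = ereal (real_of_int (j - 1))"
    using distance[of "s * (j - 1)" "a + s"] s assms by auto
  ultimately show ?thesis
    by (auto simp: nbrs_towards_def algebra_simps one_ereal_def)
qed

section \<open>The adversary's answers and the placements that survive them\<close>

text \<open>The two arcs between almost antipodal vertices have lengths \<open>n div 2\<close> and
  \<open>n - n div 2\<close>, so from any third vertex one target is reached by a shortest path
  going forward and the other by one going backward. The answer does not depend on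
  \<open>i\<close>.\<close>

lemma antipodal_both_sides:
  assumes "F a \<noteq> F i" "F a \<noteq> F (i + int (n div 2))"
  shows "valid_answer G (\<lambda>_. 1) (F i) (F (i + int (n div 2))) (F a)
    (Directions (Upair (F (a + 1)) (F (a - 1))))"
proof -
  define m where "m = int (n div 2)"
  \<comment> \<open>\<open>c\<close> counts the forward steps from \<open>F a\<close> to
    \<open>F i\<close>; the targets sit at offsets \<open>c\<close> and
    \<open>c + m\<close>.\<close>
  define c where "c = (i - a) mod int n"
  have m: "2 * m \<le> int n" "int n \<le> 2 * m + 1" unfolding m_def by linarith+
  have c: "0 \<le> c" "c < int n" using n_ge_3 by (auto simp: c_def)
  have dvd: "int n dvd i - a - c" by (simp add: c_def mod_eq_dvd_iff[symmetric])
  have Fi: "F i = F (a + c)" using dvd by (simp add: label_eq_iff algebra_simps)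
  have Fim: "F (i + m) = F (a + (c + m))" using label_shift[OF Fi, of m] by (simp add: add.assoc)
  \<comment> \<open>Turns a forward offset into a backward one, the form needed for
    \<open>s = -1\<close>.\<close>
  have wrap: "F (a + x) = F (a + - 1 * (int n - x))" for x by (simp add: label_eq_iff)
  have "c \<noteq> 0" using assms(1) Fi by auto
  have "c + m \<noteq> int n"
    using assms(2) Fim wrap[of "c + m"] by (auto simp: m_def)
  have nb: "F (a + 1) \<in> nbrs G (F a)" "F (a - 1) \<in> nbrs G (F a)"
    using arc_step[of 1 a] arc_step[of "-1" a] by (auto simp: nbrs_def)
  have fwd: "F (a + j) \<in> nbrs_towards G (\<lambda>_. 1) (F a) (F (a + 1))"
    if "1 \<le> j" "2 * j \<le> int n" for j
    using in_nbrs_towards[of 1 j a] that by simp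
  have bwd: "F (a + j) \<in> nbrs_towards G (\<lambda>_. 1) (F a) (F (a - 1))"
    if "1 \<le> int n - j" "2 * (int n - j) \<le> int n" for j
    using in_nbrs_towards[of "-1" "int n - j" a] that wrap[of j] by simp
  show ?thesis
  proof (cases "c + m < int n")
    case True
    \<comment> \<open>Both \<open>c\<close> and \<open>n - (c + m)\<close> are at most
      \<open>n - m - 1 \<le> m\<close>, hence within half the cycle.\<close>
    have "F i \<in> nbrs_towards G (\<lambda>_. 1) (F a) (F (a + 1))"
      "F (i + m) \<in> nbrs_towards G (\<lambda>_. 1) (F a) (F (a - 1))"
      unfolding Fi Fim using True m c \<open>c \<noteq> 0\<close> by (auto intro!: fwd bwd)
    then show ?thesis using assms nb unfolding m_def by auto
  next
    case False
    have "F i \<in> nbrs_towards G (\<lambda>_. 1) (F a) (F (a - 1))"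
      unfolding Fi using False m c by (intro bwd) auto
    \<comment> \<open>The second target has passed \<open>F a\<close>, so the sides are exchanged;
      the unordered pair hides this.\<close>
    moreover have "F (a + (c + m)) = F (a + (c + m - int n))" by (simp add: label_eq_iff)
    then have "F (i + m) \<in> nbrs_towards G (\<lambda>_. 1) (F a) (F (a + 1))"
      unfolding Fim using fwd[of "c + m - int n"] False m c \<open>c + m \<noteq> int n\<close> by simp
    moreover have "Upair (F (a + 1)) (F (a - 1)) = Upair (F (a - 1)) (F (a + 1))"
      by (simp add: Upair_inject)
    ultimately show ?thesis using assms nb unfolding m_def by (metis valid_answer.simps(2))
  qed
qed

text \<open>A double count over the \<open>n\<close> labels \<open>i\<close>: a vertex
  \<open>F z\<close> spoils only \<open>i = z\<close> and \<open>i = z - m\<close> modulo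
  \<open>n\<close>, so \<open>X\<close> spoils at most \<open>2 * card X\<close> labels.\<close>

lemma antipodal_pair_avoiding:
  assumes "finite X" "X \<subseteq> pverts G" "2 * card X < n"
  obtains i where "F i \<notin> X" "F (i + int (n div 2)) \<notin> X"
proof -
  define m where "m = int (n div 2)"
  define K where "K x = {i \<in> {0..<int n}. F i = x \<or> F (i + m) = x}" for x
  have "card (K x) \<le> 2" if x: "x \<in> X" for x
  proof -
    obtain z where z: "x = F z" using x assms(2) verts_eq by blast
    have "i \<in> {z mod int n, (z - m) mod int n}" if "i \<in> K x" for i
    proof -
      have i: "i mod int n = i" "int n dvd i - z \<or> int n dvd i - (z - m)"
        using that by (auto simp: K_def z label_eq_iff algebra_simps)
      then show ?thesis unfolding mod_eq_dvd_iff[symmetric] by auto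
    qed
    then have "K x \<subseteq> {z mod int n, (z - m) mod int n}" by blast
    then have "card (K x) \<le> card {z mod int n, (z - m) mod int n}" by (rule card_mono[rotated]) simp
    also have "\<dots> \<le> 2" by (simp add: card_insert_if)
    finally show ?thesis .
  qed
  then have "card (\<Union>x\<in>X. K x) \<le> (\<Sum>x\<in>X. 2)"
    by (intro order_trans[OF card_UN_le[OF assms(1)]] sum_mono)
  also have "\<dots> < card {0..<int n}" using assms(3) by simp
  finally have less: "card (\<Union>x\<in>X. K x) < card {0..<int n}" .
  have "finite (K x)" for x by (rule finite_subset[of _ "{0..<int n}"]) (auto simp: K_def)
  then have "\<not> {0..<int n} \<subseteq> (\<Union>x\<in>X. K x)"
    using card_mono[of "\<Union>x\<in>X. K x" "{0..<int n}"] assms(1) less by fastforce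
  then obtain i where "i \<in> {0..<int n}" "i \<notin> (\<Union>x\<in>X. K x)" by blast
  then have "F i \<notin> X" "F (i + m) \<notin> X" by (auto simp: K_def)
  then show thesis using that by (simp add: m_def)
qed

lemma target_pair_antipodal: "target_pair G (F i) (F (i + int (n div 2)))"
proof -
  have "\<not> int n dvd - int (n div 2)"
    using n_ge_3 zdvd_not_zless[of "int (n div 2)" "int n"] by auto
  then show ?thesis by (simp add: target_pair_def label_eq_iff)
qed

end

section \<open>Every cycle graph has an integer labelling\<close>

lemma cycle_graph_labelling:
  assumes "cycle_graph n G"
  obtains F where "labelled_cycle G n F"
proof -
  obtain f where n: "3 \<le> n" and f: "bij_betw f {..<n} (pverts G)"
    and E: "parcs G = (\<Union>i<n. {(f i, f (Suc i mod n)), (f (Suc i mod n), f i)})"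
    using assms unfolding cycle_graph_def by blast
  define F where "F a = f (nat (a mod int n))" for a
  have inj: "inj_on f {..<n}" and V: "pverts G = f ` {..<n}"
    using f by (auto simp: bij_betw_def)
  have lt: "nat (a mod int n) < n" for a using n by (simp add: nat_less_iff)
  have F_nat: "F (int i) = f (i mod n)" for i
    by (simp add: F_def nat_mod_as_int)
  have eq: "F a = F b \<longleftrightarrow> int n dvd a - b" for a b
  proof -
    have "F a = F b \<longleftrightarrow> nat (a mod int n) = nat (b mod int n)"
      unfolding F_def using inj_on_eq_iff[OF inj] lt by simp
    also have "\<dots> \<longleftrightarrow> a mod int n = b mod int n" using n by (simp add: eq_nat_nat_iff)
    finally show ?thesis by (simp add: mod_eq_dvd_iff)
  qed
  have rep: "\<exists>i<n. int n dvd a - int i" for a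
    using n by (intro exI[of _ "nat (a mod int n)"]) (simp add: lt mod_eq_dvd_iff[symmetric])
  have verts: "pverts G = range F"
  proof
    show "pverts G \<subseteq> range F"
    proof
      fix v assume "v \<in> pverts G"
      then obtain i where "i < n" "v = f i" by (auto simp: V)
      then show "v \<in> range F" using F_nat[of i] by (intro range_eqI[of _ _ "int i"]) simp
    qed
    show "range F \<subseteq> pverts G" using lt by (auto simp: V F_def)
  qed
  have step: "(F a, F (a + 1)) \<in> parcs G \<and> (F (a + 1), F a) \<in> parcs G" for a
  proof -
    obtain i where i: "i < n" "int n dvd a - int i" using rep by blast
    then have "F a = f i" "F (a + 1) = f (Suc i mod n)"
      using eq[of a "int i"] eq[of "a + 1" "int (Suc i)"] F_nat[of i] F_nat[of "Suc i"] by auto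
    then show ?thesis using i(1) unfolding E by auto
  qed
  have arc: "(u, v) \<in> parcs G \<longleftrightarrow> (\<exists>a. u = F a \<and> (v = F (a + 1) \<or> v = F (a - 1)))" for u v
  proof
    assume "(u, v) \<in> parcs G"
    then obtain i where "i < n"
      "u = f i \<and> v = f (Suc i mod n) \<or> u = f (Suc i mod n) \<and> v = f i"
      unfolding E by blast
    then have "u = F (int i) \<and> v = F (int i + 1) \<or> u = F (int i + 1) \<and> v = F (int i)"
      using F_nat[of i] F_nat[of "Suc i"] by (auto simp: add.commute)
    then show "\<exists>a. u = F a \<and> (v = F (a + 1) \<or> v = F (a - 1))"
      by (metis add_diff_cancel_right')
  next
    assume "\<exists>a. u = F a \<and> (v = F (a + 1) \<or> v = F (a - 1))"
    then show "(u, v) \<in> parcs G" using step by (metis diff_add_cancel)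
  qed
  interpret weighted_connected_graph G "\<lambda>_. 1"
    by (rule cycle_graph_weighted_connected_graph[OF assms])
  have "labelled_cycle G n F"
    by unfold_locales (use n eq verts arc in auto)
  then show thesis by (rule that)
qed

section \<open>Runs of the algorithm and the lower bound\<close>

text \<open>The answers depend only on the queried vertex, so the algorithm can simply be played
  forward, however it adapts.\<close>

lemma run_against_answers:
  obtains h where "run_of A h" "length h = q" "\<forall>(v, a)\<in>set h. a = ans v"
proof -
  have "\<exists>h. run_of A h \<and> length h = q \<and> (\<forall>(v, a)\<in>set h. a = ans v)"
  proof (induction q)
    case 0
    show ?case by (simp add: run_of_def)
  next
    case (Suc q)
    then obtain h where h: "run_of A h" "length h = q" "\<forall>(v, a)\<in>set h. a = ans v" by blast
    show ?case
      using h by (intro exI[of _ "h @ [(A h, ans (A h))]"])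
        (auto simp: run_of_def nth_append less_Suc_eq)
  qed
  then show thesis using that by blast
qed

lemma run_of_queries:
  assumes "query_algorithm G A" "run_of A h"
  shows "fst ` set h \<subseteq> pverts G"
proof
  fix v assume "v \<in> fst ` set h"
  then obtain i where "i < length h" "v = fst (h ! i)" by (auto simp: in_set_conv_nth)
  then show "v \<in> pverts G" using assms by (simp add: run_of_def query_algorithm_def)
qed

theorem theorem10:
  fixes G :: "'a pair_pre_digraph" and A :: "'a algorithm" and n q :: nat
  assumes "cycle_graph n G"
    and "query_algorithm G A"
    and "detects_within G (\<lambda>_. 1) A q"
  shows "real q \<ge> real n / 2 - 1"
proof (rule ccontr)
  assume "\<not> real q \<ge> real n / 2 - 1"
  then have q: "2 * q + 2 < n" by linarith
  obtain F where "labelled_cycle G n F" using cycle_graph_labelling[OF assms(1)] .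
  then interpret labelled_cycle G n F .
  define m where "m = int (n div 2)"
  \<comment> \<open>One answer has to serve all surviving placements at once, hence \<open>a\<close>
    is chosen before \<open>i\<close>. The function \<open>ans\<close> is then obtained on vertices,
    each of which has many labels.\<close>
  have "\<exists>a. \<forall>i. u \<noteq> F i \<longrightarrow> u \<noteq> F (i + m) \<longrightarrow>
    valid_answer G (\<lambda>_. 1) (F i) (F (i + m)) u a" if u: "u \<in> pverts G" for u
  proof -
    obtain b where "u = F b" using u verts_eq by blast
    then show ?thesis using antipodal_both_sides[of b] unfolding m_def by blast
  qed
  then have "\<forall>u\<in>pverts G. \<exists>a. \<forall>i. u \<noteq> F i \<longrightarrow> u \<noteq> F (i + m) \<longrightarrow>
    valid_answer G (\<lambda>_. 1) (F i) (F (i + m)) u a" by blast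
  from bchoice[OF this] obtain ans where ans: "\<And>u i. u \<in> pverts G \<Longrightarrow> u \<noteq> F i \<Longrightarrow>
    u \<noteq> F (i + m) \<Longrightarrow> valid_answer G (\<lambda>_. 1) (F i) (F (i + m)) u (ans u)"
    by blast
  obtain h where h: "run_of A h" "length h = q" "\<forall>(v, a)\<in>set h. a = ans v"
    using run_against_answers .
  have queries: "fst ` set h \<subseteq> pverts G" using run_of_queries[OF assms(2) h(1)] .
  have card: "card (fst ` set h) \<le> q"
    using card_image_le[of "set h" fst] card_length[of h] h(2) by simp
  have consistent: "consistent G (\<lambda>_. 1) (F i) (F (i + m)) h"
    if "F i \<notin> fst ` set h" "F (i + m) \<notin> fst ` set h" for i
    unfolding consistent_def
  proof (intro conjI ballI)
    show "target_pair G (F i) (F (i + m))" using target_pair_antipodal by (simp add: m_def)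
    fix e assume e: "e \<in> set h"
    obtain v a where va: "e = (v, a)" by fastforce
    then have v: "v \<in> fst ` set h" and a: "a = ans v" using e h(3) by force+
    have "v \<noteq> F i" "v \<noteq> F (i + m)" using that v by metis+
    then show "case e of (v, a) \<Rightarrow> valid_answer G (\<lambda>_. 1) (F i) (F (i + m)) v a"
      using ans[of v i] v queries by (auto simp: va a)
  qed
  \<comment> \<open>A first surviving placement makes \<open>h\<close> a genuine run, so that
    \<open>detects_within\<close> yields a prefix that detects some \<open>x\<close>.\<close>
  obtain i where "F i \<notin> fst ` set h" "F (i + m) \<notin> fst ` set h"
    using antipodal_pair_avoiding[of "fst ` set h"] queries card q by (auto simp: m_def)
  then obtain k x where x: "x \<in> pverts G"
    "\<And>t1 t2. consistent G (\<lambda>_. 1) t1 t2 (take k h) \<Longrightarrow> x = t1 \<or> x = t2"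
    using assms(3) consistent h(1,2) unfolding detects_within_def target_detected_def by blast
  \<comment> \<open>Counting \<open>x\<close> as one more forbidden vertex still leaves a placement,
    since \<open>2 * (q + 1) < n\<close>. It is consistent with the prefix but avoids
    \<open>x\<close>.\<close>
  have "card (insert x (fst ` set h)) \<le> q + 1"
    using card card_insert_le_m1[of "q + 1" "fst ` set h" x] by simp
  then obtain j where j: "F j \<notin> insert x (fst ` set h)" "F (j + m) \<notin> insert x (fst ` set h)"
    using antipodal_pair_avoiding[of "insert x (fst ` set h)"] queries x(1) q
    by (auto simp: m_def)
  then have "consistent G (\<lambda>_. 1) (F j) (F (j + m)) (take k h)"
    using consistent[of j] set_take_subset[of k h] unfolding consistent_def by auto
  then show False using x(2) j by blast
qed

end
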